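(* Let $\mathbf P=(P,\leq)$ be a poset, let $f\colon P\to P$ be strongly monotone and let $\Theta$ be an $S$-equivalence on $\mathbf P$. Define a relation $\leq$ on $P/\Theta$ by $[a]\Theta\leq[b]\Theta$ if there exist $a'\in[a]\Theta$ and $b'\in[b]\Theta$ with $a'\leq b'$. Then: (i) $\ker f=\{(x,y)\in P^2\mid f(x)=f(y)\}$ is an $S$-equivalence on $\mathbf P$; (ii) $(P/\Theta,\leq)$ is a poset and the mapping $x\mapsto[x]\Theta$ from $(P,\leq)$ to $(P/\Theta,\leq)$ is strongly monotone.
   Context: For posets $(P,\leq)$, $(Q,\leq)$, a mapping $f\colon P\to Q$ is strongly monotone if it is monotone (i.e.\ $x\leq y$ implies $f(x)\leq f(y)$) and whenever $a,b\in P$ satisfy $f(a)\leq f(b)$ there exist $a',b'\in P$ with $f(a')=f(a)$, $f(b')=f(b)$ and $a'\leq b'$. An equivalence relation $\Theta$ on a poset $(P,\leq)$ is an $S$-equivalence if: (i) whenever $a,b,b',c\in P$ with $a\leq b$, $b'\leq c$ and $(b,b')\in\Theta$, there exist $a'\in[a]\Theta$ and $c'\in[c]\Theta$ with $a'\leq c'$; and (ii) whenever $a,a',b,b'\in P$ with $a\leq b$, $b'\leq a'$ and $(a,a'),(b,b')\in\Theta$, we have $(a,b)\in\Theta$. *)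

theory Defs
  imports Main "HOL-Library.FuncSet"
begin

definition strongly_monotone ::
  "'a set \<Rightarrow> 'a rel \<Rightarrow> 'b set \<Rightarrow> 'b rel \<Rightarrow> ('a \<Rightarrow> 'b) \<Rightarrow> bool" where
  "strongly_monotone P r Q s f \<longleftrightarrow>
     f \<in> P \<rightarrow> Q \<and>
     monotone_on P (\<lambda>x y. (x, y) \<in> r) (\<lambda>x y. (x, y) \<in> s) f \<and>
     (\<forall>a\<in>P. \<forall>b\<in>P. (f a, f b) \<in> s \<longrightarrow>
        (\<exists>a'\<in>P. \<exists>b'\<in>P. f a' = f a \<and> f b' = f b \<and> (a', b') \<in> r))"

definition S_equivalence :: "'a set \<Rightarrow> 'a rel \<Rightarrow> 'a rel \<Rightarrow> bool" where
  "S_equivalence P r \<Theta> \<longleftrightarrow>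
     equiv P \<Theta> \<and>
     (\<forall>a\<in>P. \<forall>b\<in>P. \<forall>b'\<in>P. \<forall>c\<in>P.
        (a, b) \<in> r \<and> (b', c) \<in> r \<and> (b, b') \<in> \<Theta> \<longrightarrow>
        (\<exists>a'\<in>\<Theta> `` {a}. \<exists>c'\<in>\<Theta> `` {c}. (a', c') \<in> r)) \<and>
     (\<forall>a\<in>P. \<forall>a'\<in>P. \<forall>b\<in>P. \<forall>b'\<in>P.
        (a, b) \<in> r \<and> (b', a') \<in> r \<and> (a, a') \<in> \<Theta> \<and> (b, b') \<in> \<Theta> \<longrightarrow>
        (a, b) \<in> \<Theta>)"

definition kernel_on :: "'a set \<Rightarrow> ('a \<Rightarrow> 'b) \<Rightarrow> 'a rel" where
  "kernel_on P f = {(x, y) \<in> P \<times> P. f x = f y}"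

definition quotient_order :: "'a set \<Rightarrow> 'a rel \<Rightarrow> 'a rel \<Rightarrow> 'a set rel" where
  "quotient_order P r \<Theta> =
     {(\<Theta> `` {a}, \<Theta> `` {b}) | a b. a \<in> P \<and> b \<in> P \<and>
        (\<exists>a'\<in>\<Theta> `` {a}. \<exists>b'\<in>\<Theta> `` {b}. (a', b') \<in> r)}"

end

theory Submission
  imports Defs
begin

text \<open>The two conditions on an S-equivalence are what transitivity and antisymmetry of an
  order become when points are only known up to equivalence. For a kernel
  (\<open>S_equivalence_kernel_on\<close>), monotonicity carries the given inequalities to the
  images. There transitivity followed by lifting along \<open>f\<close> yields condition (i), and
  antisymmetry yields condition (ii). Conversely, for a quotient
  (\<open>partial_order_on_quotient_order\<close>), condition (i) gives transitivity of the order on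
  classes and condition (ii) its antisymmetry. The projection onto classes is strongly monotone by
  construction (\<open>strongly_monotone_quotient_map\<close>): classes are comparable exactly when
  some of their members are, and those members are the preimages to be found.\<close>

lemma S_equivalence_kernel_on:
  assumes s: "partial_order_on Q s" and f: "strongly_monotone P r Q s f"
  shows "S_equivalence P r (kernel_on P f)"
proof -
  have tr: "trans s" and an: "antisym s"
    using s by (auto simp: partial_order_on_def preorder_on_def)
  have mono: "(f x, f y) \<in> s" if "x \<in> P" "y \<in> P" "(x, y) \<in> r" for x y
    using f that by (auto simp: strongly_monotone_def monotone_on_def)
  have lift: "\<exists>a'\<in>P. \<exists>b'\<in>P. f a' = f a \<and> f b' = f b \<and> (a', b') \<in> r"
    if "a \<in> P" "b \<in> P" "(f a, f b) \<in> s" for a b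
    using f that by (auto simp: strongly_monotone_def)
  have "equiv P (kernel_on P f)"
    by (auto simp: kernel_on_def equiv_def refl_on_def sym_def trans_def)
  moreover have "\<exists>a'\<in>kernel_on P f `` {a}. \<exists>c'\<in>kernel_on P f `` {c}. (a', c') \<in> r"
    if "a \<in> P" "b \<in> P" "b' \<in> P" "c \<in> P" "(a, b) \<in> r" "(b', c) \<in> r"
      "(b, b') \<in> kernel_on P f" for a b b' c
  proof -
    have "(f a, f b) \<in> s" "(f b', f c) \<in> s"
      using that mono by blast+
    moreover have "f b = f b'"
      using that by (simp add: kernel_on_def)
    ultimately have "(f a, f c) \<in> s"
      using tr by (auto dest: transD)
    \<comment> \<open>Strong monotonicity returns points with the same images as \<open>a\<close>
      and \<open>c\<close>, that is, other members of their kernel classes. This is exactly the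
      freedom that condition (i) grants.\<close>
    from lift[OF \<open>a \<in> P\<close> \<open>c \<in> P\<close> this] obtain a' c'
      where "a' \<in> P" "c' \<in> P" "f a' = f a" "f c' = f c" "(a', c') \<in> r"
      by blast
    moreover from this \<open>a \<in> P\<close> \<open>c \<in> P\<close>
    have "a' \<in> kernel_on P f `` {a}" "c' \<in> kernel_on P f `` {c}"
      by (simp_all add: kernel_on_def)
    ultimately show ?thesis
      by blast
  qed
  moreover have "(a, b) \<in> kernel_on P f"
    if "a \<in> P" "a' \<in> P" "b \<in> P" "b' \<in> P" "(a, b) \<in> r" "(b', a') \<in> r"
      "(a, a') \<in> kernel_on P f" "(b, b') \<in> kernel_on P f" for a a' b b'
  proof -
    have "(f a, f b) \<in> s" "(f b', f a') \<in> s"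
      using that mono by blast+
    moreover have "f a = f a'" "f b = f b'"
      using that by (simp_all add: kernel_on_def)
    \<comment> \<open>After identifying \<open>f a'\<close> with \<open>f a\<close> and
      \<open>f b'\<close> with \<open>f b\<close>, the two image inequalities run in opposite
      directions.\<close>
    ultimately have "f a = f b"
      using an by (auto dest: antisymD)
    with that show ?thesis
      by (simp add: kernel_on_def)
  qed
  ultimately show ?thesis
    unfolding S_equivalence_def by blast
qed

lemma quotient_order_iff:
  "(A, B) \<in> quotient_order P r \<Theta> \<longleftrightarrow>
     A \<in> P // \<Theta> \<and> B \<in> P // \<Theta> \<and> (\<exists>a\<in>A. \<exists>b\<in>B. (a, b) \<in> r)"
  by (auto simp: quotient_order_def quotient_def)

lemma partial_order_on_quotient_order:
  assumes r: "partial_order_on P r" and S: "S_equivalence P r \<Theta>"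
  shows "partial_order_on (P // \<Theta>) (quotient_order P r \<Theta>)"
proof -
  have rfl: "(x, x) \<in> r" if "x \<in> P" for x
    using r that by (auto simp: partial_order_on_def preorder_on_def refl_on_def)
  have eq: "equiv P \<Theta>"
    using S by (simp add: S_equivalence_def)
  have in_P: "x \<in> P" if "A \<in> P // \<Theta>" "x \<in> A" for x A
    using that in_quotient_imp_subset[OF eq] by blast
  have rel: "(x, y) \<in> \<Theta>" if "A \<in> P // \<Theta>" "x \<in> A" "y \<in> A" for x y A
    using quotient_eq_iff[OF eq that(1,1,2,3)] by simp
  have cls: "\<Theta> `` {x} = A" if "A \<in> P // \<Theta>" "x \<in> A" for x A
  proof -
    obtain z where "A = \<Theta> `` {z}"
      using \<open>A \<in> P // \<Theta>\<close> by (rule quotientE)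
    with \<open>x \<in> A\<close> equiv_class_eq[OF eq, of z x] show ?thesis
      by simp
  qed
  have "quotient_order P r \<Theta> \<subseteq> (P // \<Theta>) \<times> (P // \<Theta>)"
    by (auto simp: quotient_order_iff)
  moreover have "refl_on (P // \<Theta>) (quotient_order P r \<Theta>)"
  proof (rule refl_onI)
    fix A
    assume A: "A \<in> P // \<Theta>"
    then obtain x where "x \<in> A"
      using in_quotient_imp_non_empty[OF eq] by blast
    with A show "(A, A) \<in> quotient_order P r \<Theta>"
      using rfl[OF in_P] by (auto simp: quotient_order_iff)
  qed
  moreover have "trans (quotient_order P r \<Theta>)"
  proof (rule transI)
    fix A B C
    assume "(A, B) \<in> quotient_order P r \<Theta>" "(B, C) \<in> quotient_order P r \<Theta>"
    then obtain a b b' c where *: "A \<in> P // \<Theta>" "B \<in> P // \<Theta>" "C \<in> P // \<Theta>"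
      "a \<in> A" "b \<in> B" "b' \<in> B" "c \<in> C" "(a, b) \<in> r" "(b', c) \<in> r"
      by (auto simp: quotient_order_iff)
    then have "a \<in> P" "b \<in> P" "b' \<in> P" "c \<in> P" "(b, b') \<in> \<Theta>"
      using in_P rel by blast+
    \<comment> \<open>The two comparisons may meet \<open>B\<close> in different members
      \<open>b\<close> and \<open>b'\<close>. Condition (i) bridges this gap, at the price of moving
      the end points within their classes.\<close>
    with * S have "\<exists>a'\<in>\<Theta> `` {a}. \<exists>c'\<in>\<Theta> `` {c}. (a', c') \<in> r"
      unfolding S_equivalence_def by blast
    with * show "(A, C) \<in> quotient_order P r \<Theta>"
      by (simp add: cls quotient_order_iff)
  qed
  moreover have "antisym (quotient_order P r \<Theta>)"
  proof (rule antisymI)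
    fix A B
    assume "(A, B) \<in> quotient_order P r \<Theta>" "(B, A) \<in> quotient_order P r \<Theta>"
    then obtain a b b' a' where *: "A \<in> P // \<Theta>" "B \<in> P // \<Theta>"
      "a \<in> A" "b \<in> B" "b' \<in> B" "a' \<in> A" "(a, b) \<in> r" "(b', a') \<in> r"
      by (auto simp: quotient_order_iff)
    then have "a \<in> P" "b \<in> P" "b' \<in> P" "a' \<in> P" "(a, a') \<in> \<Theta>" "(b, b') \<in> \<Theta>"
      using in_P rel by blast+
    \<comment> \<open>The comparisons between \<open>A\<close> and \<open>B\<close> in the two
      directions may use different members. Condition (ii) still puts \<open>a\<close> and
      \<open>b\<close> in one class, so the classes coincide.\<close>
    with * S have "(a, b) \<in> \<Theta>"
      unfolding S_equivalence_def by blast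
    with * show "A = B"
      using cls equiv_class_eq[OF eq] by metis
  qed
  ultimately show ?thesis
    by (simp add: partial_order_on_def preorder_on_def)
qed

lemma strongly_monotone_quotient_map:
  assumes eq: "equiv P \<Theta>"
  shows "strongly_monotone P r (P // \<Theta>) (quotient_order P r \<Theta>) (\<lambda>x. \<Theta> `` {x})"
proof -
  have self: "x \<in> \<Theta> `` {x}" if "x \<in> P" for x
    using equiv_class_self[OF eq that] .
  have mem: "y \<in> P \<and> \<Theta> `` {y} = \<Theta> `` {x}" if "y \<in> \<Theta> `` {x}" for x y
    using that equiv_class_eq_iff[OF eq, of x y] by auto
  have "(\<lambda>x. \<Theta> `` {x}) \<in> P \<rightarrow> P // \<Theta>"
    by (auto intro: quotientI)
  moreover have "monotone_on P (\<lambda>x y. (x, y) \<in> r)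
      (\<lambda>A B. (A, B) \<in> quotient_order P r \<Theta>) (\<lambda>x. \<Theta> `` {x})"
    unfolding monotone_on_def quotient_order_iff by (meson self quotientI)
  \<comment> \<open>The members that witness the comparison of the two classes are the required
    preimages: by \<open>mem\<close> each lies in \<open>P\<close> and has the same class as the
    point it replaces.\<close>
  moreover have "\<exists>a'\<in>P. \<exists>b'\<in>P. \<Theta> `` {a'} = \<Theta> `` {a} \<and> \<Theta> `` {b'} = \<Theta> `` {b} \<and> (a', b') \<in> r"
    if "(\<Theta> `` {a}, \<Theta> `` {b}) \<in> quotient_order P r \<Theta>" for a b
    using that unfolding quotient_order_iff by (meson mem)
  ultimately show ?thesis
    unfolding strongly_monotone_def by blast
qed

theorem theorem5p4:
  fixes P :: "'a set" and r :: "'a rel" and \<Theta> :: "'a rel" and f :: "'a \<Rightarrow> 'a"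
  assumes "partial_order_on P r"
    and "strongly_monotone P r P r f"
    and "S_equivalence P r \<Theta>"
  shows "S_equivalence P r (kernel_on P f) \<and>
    partial_order_on (P // \<Theta>) (quotient_order P r \<Theta>) \<and>
    strongly_monotone P r (P // \<Theta>) (quotient_order P r \<Theta>) (\<lambda>x. \<Theta> `` {x})"
proof -
  from assms(3) have "equiv P \<Theta>"
    by (simp add: S_equivalence_def)
  then show ?thesis
    using S_equivalence_kernel_on[OF assms(1,2)] partial_order_on_quotient_order[OF assms(1,3)]
      strongly_monotone_quotient_map by blast
qed

end
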